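(* Let $X$ be a set with a distance $\mathbf{d}$ and let $Q$ be a topological space. If $X$ is $\mathbf{d}$-complete, then the set $C(Q,X^{\mathsf{F}\bullet})$ of functions $Q\to X$ that are continuous with respect to the $\mathbf{d}$-finite topology $X^{\mathsf{F}\bullet}$ on $X$ is $\sup\text{-}\mathbf{d}$-complete.
   Context: A distance on a set $X$ is a function $\mathbf{d}:X\times X\to[0,\infty]$ satisfying the triangle inequality $\mathbf{d}(x,y)\leq\mathbf{d}(x,z)+\mathbf{d}(z,y)$ for all $x,y,z\in X$ (no symmetry, and $\mathbf{d}(x,x)=0$ is not required). The supremum distance on functions $Q\to X$ is $\sup\text{-}\mathbf{d}(f,g)=\sup_{p\in Q}\mathbf{d}(f(p),g(p))$. A net is a family indexed by a (nonempty) set $\Lambda$ with a transitive, possibly non-reflexive, relation $\prec$ such that for all $\gamma,\delta\in\Lambda$ there is $\lambda\in\Lambda$ with $\gamma,\delta\prec\lambda$; $\liminf_\lambda r_\lambda=\lim_\gamma\inf_{\gamma\prec\lambda}r_\lambda$ and $\limsup_\lambda r_\lambda=\lim_\gamma\sup_{\gamma\prec\lambda}r_\lambda$. For any set $Z$ with a distance $\mathbf{e}$: - A net $(z_\lambda)\subseteq Z$ is $\mathbf{e}$-Cauchy if $\lim_\gamma\sup_{\gamma\prec\delta}\mathbf{e}(z_\gamma,z_\delta)=0$. - $z\in Z$ is a $Z^\circ_\circ$-limit of $(z_\lambda)\subseteq Z$ if for all $c\in Z$ both $\liminf_\lambda\mathbf{e}(z_\lambda,c)\geq\mathbf{e}(z,c)$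 and $\liminf_\lambda\mathbf{e}(c,z_\lambda)\geq\mathbf{e}(c,z)$. - $Z$ is $\mathbf{e}$-complete if every $\mathbf{e}$-Cauchy net in $Z$ has a $Z^\circ_\circ$-limit in $Z$. The set $X^{\mathsf{F}}$ of $\mathbf{d}$-finite elements of $X$ consists of all $y\in X$ such that $\mathbf{d}(y,x_\lambda)\to\mathbf{d}(y,x)$ whenever $(x_\lambda)\subseteq X$ is $\mathbf{d}$-Cauchy and $x\in X$ is an $X^\circ_\circ$-limit of $(x_\lambda)$. The $\mathbf{d}$-finite topology $X^{\mathsf{F}\bullet}$ on $X$ is the topology generated (by arbitrary unions of finite intersections) by the balls $\{x\in X:\mathbf{d}(c,x)<\epsilon\}$ with $c\in X^{\mathsf{F}}$ and $\epsilon>0$. *)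

theory Defs
  imports "HOL-Analysis.Analysis"
begin

definition distance_on :: "'a set \<Rightarrow> ('a \<Rightarrow> 'a \<Rightarrow> ennreal) \<Rightarrow> bool" where
  "distance_on X d \<longleftrightarrow> (\<forall>x\<in>X. \<forall>y\<in>X. \<forall>z\<in>X. d x y \<le> d x z + d z y)"

definition sup_dist :: "'q set \<Rightarrow> ('a \<Rightarrow> 'a \<Rightarrow> ennreal) \<Rightarrow> ('q \<Rightarrow> 'a) \<Rightarrow> ('q \<Rightarrow> 'a) \<Rightarrow> ennreal" where
  "sup_dist Q d f g = (SUP p\<in>Q. d (f p) (g p))"

definition directed_index :: "'i set \<Rightarrow> ('i \<Rightarrow> 'i \<Rightarrow> bool) \<Rightarrow> bool" where
  "directed_index \<Lambda> prec \<longleftrightarrow> \<Lambda> \<noteq> {} \<and> transp_on \<Lambda> prec \<and>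
     (\<forall>\<gamma>\<in>\<Lambda>. \<forall>\<delta>\<in>\<Lambda>. \<exists>\<mu>\<in>\<Lambda>. prec \<gamma> \<mu> \<and> prec \<delta> \<mu>)"

text \<open>
  The filter of tails of a directed index set. Convergence along a net is convergence along this
  filter, and the inferior limit of a net is \<^const>\<open>Liminf\<close> along it
  (see \<open>Liminf_net_filter\<close> below).
\<close>

definition net_filter :: "'i set \<Rightarrow> ('i \<Rightarrow> 'i \<Rightarrow> bool) \<Rightarrow> 'i filter" where
  "net_filter \<Lambda> prec = (INF \<gamma>\<in>\<Lambda>. principal {\<mu>\<in>\<Lambda>. prec \<gamma> \<mu>})"

definition cauchy_net ::
    "('a \<Rightarrow> 'a \<Rightarrow> ennreal) \<Rightarrow> 'i set \<Rightarrow> ('i \<Rightarrow> 'i \<Rightarrow> bool) \<Rightarrow> ('i \<Rightarrow> 'a) \<Rightarrow> bool" where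
  "cauchy_net e \<Lambda> prec z \<longleftrightarrow>
     ((\<lambda>\<gamma>. SUP \<delta>\<in>{\<delta>\<in>\<Lambda>. prec \<gamma> \<delta>}. e (z \<gamma>) (z \<delta>)) \<longlongrightarrow> 0) (net_filter \<Lambda> prec)"

definition net_limit ::
    "'a set \<Rightarrow> ('a \<Rightarrow> 'a \<Rightarrow> ennreal) \<Rightarrow> 'i set \<Rightarrow> ('i \<Rightarrow> 'i \<Rightarrow> bool) \<Rightarrow> ('i \<Rightarrow> 'a) \<Rightarrow> 'a \<Rightarrow> bool" where
  "net_limit Z e \<Lambda> prec z l \<longleftrightarrow> l \<in> Z \<and>
     (\<forall>c\<in>Z. Liminf (net_filter \<Lambda> prec) (\<lambda>\<mu>. e (z \<mu>) c) \<ge> e l c \<and>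
            Liminf (net_filter \<Lambda> prec) (\<lambda>\<mu>. e c (z \<mu>)) \<ge> e c l)"

text \<open>
  Completeness and finiteness quantify over nets with arbitrary index sets, whereas a definition
  can only quantify over index sets within one type. For nets in a set of elements of type
  \<open>'a\<close>, the index type \<open>'a \<times> 'a set \<times> nat\<close> loses nothing: the lemmas
  \<open>net_completeD\<close> and \<open>finite_elementsD\<close> below derive the defining properties for index
  sets of an arbitrary type.
\<close>

type_synonym 'a net_index = "'a \<times> 'a set \<times> nat"

definition net_complete :: "'a set \<Rightarrow> ('a \<Rightarrow> 'a \<Rightarrow> ennreal) \<Rightarrow> bool" where
  "net_complete Z e \<longleftrightarrow>
     (\<forall>(\<Lambda> :: 'a net_index set) prec z.
        directed_index \<Lambda> prec \<and> z \<in> \<Lambda> \<rightarrow> Z \<and> cauchy_net e \<Lambda> prec z \<longrightarrow>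
        (\<exists>l. net_limit Z e \<Lambda> prec z l))"

definition finite_elements :: "'a set \<Rightarrow> ('a \<Rightarrow> 'a \<Rightarrow> ennreal) \<Rightarrow> 'a set" where
  "finite_elements X d =
     {y\<in>X. \<forall>(\<Lambda> :: 'a net_index set) prec x l.
        directed_index \<Lambda> prec \<and> x \<in> \<Lambda> \<rightarrow> X \<and> cauchy_net d \<Lambda> prec x \<and>
        net_limit X d \<Lambda> prec x l \<longrightarrow>
        ((\<lambda>\<mu>. d y (x \<mu>)) \<longlongrightarrow> d y l) (net_filter \<Lambda> prec)}"

text \<open>
  \<^const>\<open>topology_generated_by\<close> only admits nonempty intersections. Inserting the carrier
  accounts for the empty one; otherwise the union of the balls would be the underlying space.
\<close>

definition finite_topology :: "'a set \<Rightarrow> ('a \<Rightarrow> 'a \<Rightarrow> ennreal) \<Rightarrow> 'a topology" where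
  "finite_topology X d =
     topology_generated_by
       (insert X {{x\<in>X. d c x < ennreal \<epsilon>} | c \<epsilon>. c \<in> finite_elements X d \<and> \<epsilon> > 0})"

text \<open>Extensionality makes the elements correspond exactly to functions on \<open>topspace Q\<close>.\<close>

definition cont_funs :: "'q topology \<Rightarrow> 'a topology \<Rightarrow> ('q \<Rightarrow> 'a) set" where
  "cont_funs Q T = {f \<in> extensional (topspace Q). continuous_map Q T f}"

lemma topspace_finite_topology: "topspace (finite_topology X d) = X"
  unfolding finite_topology_def topology_generated_by_topspace by auto

lemma eventually_net_filter:
  assumes "directed_index \<Lambda> prec"
  shows "eventually P (net_filter \<Lambda> prec) \<longleftrightarrow> (\<exists>\<gamma>\<in>\<Lambda>. \<forall>\<mu>\<in>\<Lambda>. prec \<gamma> \<mu> \<longrightarrow> P \<mu>)"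
proof -
  have dir: "\<exists>c\<in>\<Lambda>. principal {\<mu>\<in>\<Lambda>. prec c \<mu>} \<le>
      inf (principal {\<mu>\<in>\<Lambda>. prec a \<mu>}) (principal {\<mu>\<in>\<Lambda>. prec b \<mu>})"
    if ab: "a \<in> \<Lambda>" "b \<in> \<Lambda>" for a b
  proof -
    obtain c where c: "c \<in> \<Lambda>" "prec a c" "prec b c"
      using assms ab unfolding directed_index_def by blast
    have "{\<mu>\<in>\<Lambda>. prec c \<mu>} \<subseteq> {\<mu>\<in>\<Lambda>. prec a \<mu>} \<inter> {\<mu>\<in>\<Lambda>. prec b \<mu>}"
      using assms ab c unfolding directed_index_def transp_on_def by blast
    then show ?thesis using c(1) by auto
  qed
  have "eventually P (net_filter \<Lambda> prec) \<longleftrightarrow>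
      (\<exists>\<gamma>\<in>\<Lambda>. eventually P (principal {\<mu>\<in>\<Lambda>. prec \<gamma> \<mu>}))"
    unfolding net_filter_def
    by (rule eventually_INF_base) (use assms dir in \<open>auto simp: directed_index_def\<close>)
  then show ?thesis unfolding eventually_principal by blast
qed

lemma net_filter_neq_bot:
  assumes "directed_index \<Lambda> prec"
  shows "net_filter \<Lambda> prec \<noteq> bot"
  using eventually_net_filter[OF assms, of "\<lambda>_. False"] assms
  unfolding trivial_limit_def directed_index_def by blast

lemma Liminf_net_filter:
  fixes r :: "'i \<Rightarrow> ennreal"
  assumes "directed_index \<Lambda> prec"
  shows "Liminf (net_filter \<Lambda> prec) r = (SUP \<gamma>\<in>\<Lambda>. INF \<mu>\<in>{\<mu>\<in>\<Lambda>. prec \<gamma> \<mu>}. r \<mu>)"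
    and "((\<lambda>\<gamma>. INF \<mu>\<in>{\<mu>\<in>\<Lambda>. prec \<gamma> \<mu>}. r \<mu>) \<longlongrightarrow> Liminf (net_filter \<Lambda> prec) r) (net_filter \<Lambda> prec)"
proof -
  let ?m = "\<lambda>\<gamma>. INF \<mu>\<in>{\<mu>\<in>\<Lambda>. prec \<gamma> \<mu>}. r \<mu>"
  show eq: "Liminf (net_filter \<Lambda> prec) r = (SUP \<gamma>\<in>\<Lambda>. ?m \<gamma>)"
  proof (rule antisym)
    show "Liminf (net_filter \<Lambda> prec) r \<le> (SUP \<gamma>\<in>\<Lambda>. ?m \<gamma>)"
      unfolding Liminf_def
    proof (rule SUP_least)
      fix P assume "P \<in> {P. eventually P (net_filter \<Lambda> prec)}"
      then obtain \<gamma> where \<gamma>: "\<gamma> \<in> \<Lambda>" "\<forall>\<mu>\<in>\<Lambda>. prec \<gamma> \<mu> \<longrightarrow> P \<mu>"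
        using eventually_net_filter[OF assms] by auto
      have "(INF x\<in>Collect P. r x) \<le> ?m \<gamma>"
        by (rule INF_superset_mono) (use \<gamma> in auto)
      also have "\<dots> \<le> (SUP \<gamma>\<in>\<Lambda>. ?m \<gamma>)" using \<gamma>(1) by (rule SUP_upper)
      finally show "(INF x\<in>Collect P. r x) \<le> (SUP \<gamma>\<in>\<Lambda>. ?m \<gamma>)" .
    qed
    show "(SUP \<gamma>\<in>\<Lambda>. ?m \<gamma>) \<le> Liminf (net_filter \<Lambda> prec) r"
    proof (rule SUP_least)
      fix \<gamma> assume "\<gamma> \<in> \<Lambda>"
      then have "eventually (\<lambda>\<mu>. \<mu> \<in> \<Lambda> \<and> prec \<gamma> \<mu>) (net_filter \<Lambda> prec)"
        using eventually_net_filter[OF assms] by blast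
      then show "?m \<gamma> \<le> Liminf (net_filter \<Lambda> prec) r"
        unfolding Liminf_def by (intro SUP_upper2[where i="\<lambda>\<mu>. \<mu> \<in> \<Lambda> \<and> prec \<gamma> \<mu>"]) auto
    qed
  qed
  show "(?m \<longlongrightarrow> Liminf (net_filter \<Lambda> prec) r) (net_filter \<Lambda> prec)"
  proof (rule order_tendstoI)
    fix a assume "a < Liminf (net_filter \<Lambda> prec) r"
    then obtain \<gamma> where \<gamma>: "\<gamma> \<in> \<Lambda>" "a < ?m \<gamma>"
      unfolding eq less_SUP_iff by blast
    have "a < ?m \<mu>" if "\<mu> \<in> \<Lambda>" "prec \<gamma> \<mu>" for \<mu>
    proof -
      have "?m \<gamma> \<le> ?m \<mu>"
        by (rule INF_superset_mono)
          (use assms \<gamma>(1) that in \<open>auto simp: directed_index_def dest: transp_onD\<close>)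
      with \<gamma>(2) show ?thesis by (rule less_le_trans)
    qed
    then show "\<forall>\<^sub>F \<mu> in net_filter \<Lambda> prec. a < ?m \<mu>"
      using eventually_net_filter[OF assms] \<gamma>(1) by blast
  next
    fix a assume a: "Liminf (net_filter \<Lambda> prec) r < a"
    have "?m \<mu> < a" if "\<mu> \<in> \<Lambda>" for \<mu>
      using SUP_upper[OF that, of ?m] a unfolding eq by (rule le_less_trans)
    then show "\<forall>\<^sub>F \<mu> in net_filter \<Lambda> prec. ?m \<mu> < a"
      using eventually_net_filter[OF assms] assms unfolding directed_index_def by blast
  qed
qed

lemma cauchy_net_iff:
  assumes "directed_index \<Lambda> prec"
  shows "cauchy_net e \<Lambda> prec z \<longleftrightarrow>
    (\<forall>k::nat. \<exists>\<gamma>\<^sub>0\<in>\<Lambda>. \<forall>\<gamma>\<in>\<Lambda>. prec \<gamma>\<^sub>0 \<gamma> \<longrightarrow>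
      (\<forall>\<delta>\<in>\<Lambda>. prec \<gamma> \<delta> \<longrightarrow> e (z \<gamma>) (z \<delta>) \<le> ennreal (1 / Suc k)))"
    (is "_ \<longleftrightarrow> ?R")
proof
  assume "cauchy_net e \<Lambda> prec z"
  show ?R
  proof
    fix k
    have "(0::ennreal) < ennreal (1 / Suc k)" by (simp add: ennreal_zero_less_divide)
    with \<open>cauchy_net e \<Lambda> prec z\<close> have
      "\<forall>\<^sub>F \<gamma> in net_filter \<Lambda> prec. (SUP \<delta>\<in>{\<delta>\<in>\<Lambda>. prec \<gamma> \<delta>}. e (z \<gamma>) (z \<delta>)) < ennreal (1 / Suc k)"
      unfolding cauchy_net_def by (rule order_tendstoD)
    then obtain \<gamma>\<^sub>0 where \<gamma>\<^sub>0: "\<gamma>\<^sub>0 \<in> \<Lambda>" and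
      *: "\<And>\<gamma>. \<gamma> \<in> \<Lambda> \<Longrightarrow> prec \<gamma>\<^sub>0 \<gamma> \<Longrightarrow> (SUP \<delta>\<in>{\<delta>\<in>\<Lambda>. prec \<gamma> \<delta>}. e (z \<gamma>) (z \<delta>)) < ennreal (1 / Suc k)"
      unfolding eventually_net_filter[OF assms] by blast
    have "e (z \<gamma>) (z \<delta>) \<le> ennreal (1 / Suc k)"
      if "\<gamma> \<in> \<Lambda>" "prec \<gamma>\<^sub>0 \<gamma>" "\<delta> \<in> \<Lambda>" "prec \<gamma> \<delta>" for \<gamma> \<delta>
    proof -
      have "e (z \<gamma>) (z \<delta>) \<le> (SUP \<delta>\<in>{\<delta>\<in>\<Lambda>. prec \<gamma> \<delta>}. e (z \<gamma>) (z \<delta>))"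
        by (rule SUP_upper) (use that in auto)
      with *[OF that(1,2)] show ?thesis by (meson le_less_trans less_imp_le)
    qed
    with \<gamma>\<^sub>0 show "\<exists>\<gamma>\<^sub>0\<in>\<Lambda>. \<forall>\<gamma>\<in>\<Lambda>. prec \<gamma>\<^sub>0 \<gamma> \<longrightarrow>
      (\<forall>\<delta>\<in>\<Lambda>. prec \<gamma> \<delta> \<longrightarrow> e (z \<gamma>) (z \<delta>) \<le> ennreal (1 / Suc k))" by blast
  qed
next
  assume R: ?R
  show "cauchy_net e \<Lambda> prec z"
    unfolding cauchy_net_def
  proof (rule order_tendstoI)
    fix a :: ennreal assume "0 < a"
    then obtain e' where e': "0 < e'" "e' < a" using dense by blast
    obtain b where b: "0 < b" "ennreal b < a"
      using e' by (cases e') auto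
    obtain k where k: "1 / Suc k < b"
      using nat_approx_posE[OF b(1)] by blast
    obtain \<gamma>\<^sub>0 where \<gamma>\<^sub>0: "\<gamma>\<^sub>0 \<in> \<Lambda>" and *: "\<And>\<gamma> \<delta>. \<gamma> \<in> \<Lambda> \<Longrightarrow> prec \<gamma>\<^sub>0 \<gamma> \<Longrightarrow> \<delta> \<in> \<Lambda> \<Longrightarrow> prec \<gamma> \<delta> \<Longrightarrow>
        e (z \<gamma>) (z \<delta>) \<le> ennreal (1 / Suc k)"
      using R by blast
    have "(SUP \<delta>\<in>{\<delta>\<in>\<Lambda>. prec \<gamma> \<delta>}. e (z \<gamma>) (z \<delta>)) < a" if "\<gamma> \<in> \<Lambda>" "prec \<gamma>\<^sub>0 \<gamma>" for \<gamma>
    proof -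
      have "(SUP \<delta>\<in>{\<delta>\<in>\<Lambda>. prec \<gamma> \<delta>}. e (z \<gamma>) (z \<delta>)) \<le> ennreal (1 / Suc k)"
        by (rule SUP_least) (use * that in auto)
      also have "\<dots> \<le> ennreal b" using k by (intro ennreal_leI) simp
      also note b(2)
      finally show ?thesis .
    qed
    with \<gamma>\<^sub>0 show "\<forall>\<^sub>F \<gamma> in net_filter \<Lambda> prec. (SUP \<delta>\<in>{\<delta>\<in>\<Lambda>. prec \<gamma> \<delta>}. e (z \<gamma>) (z \<delta>)) < a"
      unfolding eventually_net_filter[OF assms] by blast
  qed simp
qed

text \<open>
  Every Cauchy net has the same tails, as a filter on the target, as a Cauchy net over
  \<^typ>\<open>'a net_index\<close>: index a point \<open>x\<close> by the sets \<open>A \<ni> x\<close> of the tail filter, and let an index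
  precede those sets only on which all eventual bounds \<open>e x y \<le> 1 / Suc k\<close>, \<open>k \<le> n\<close>, hold.
\<close>

lemma cauchy_net_reindex:
  fixes z :: "'i \<Rightarrow> 'a"
  assumes dir: "directed_index \<Lambda> prec" and zZ: "z \<in> \<Lambda> \<rightarrow> Z" and cau: "cauchy_net e \<Lambda> prec z"
  obtains M :: "'a net_index set" and R w where
    "directed_index M R" "w \<in> M \<rightarrow> Z" "cauchy_net e M R w"
    "filtermap w (net_filter M R) = filtermap z (net_filter \<Lambda> prec)"
proof -
  define F where "F = filtermap z (net_filter \<Lambda> prec)"
  define B where "B = (\<lambda>(k::nat) x y. e x y \<le> ennreal (1 / Suc k))"
  define M :: "'a net_index set" where
    "M = {(x, A, n). x \<in> A \<and> A \<subseteq> Z \<and> (\<forall>\<^sub>F y in F. y \<in> A)}"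
  define R :: "'a net_index \<Rightarrow> 'a net_index \<Rightarrow> bool" where
    "R = (\<lambda>(x, A, n) (x', A', n'). A' \<subseteq> A \<and> n \<le> n' \<and>
        (\<forall>k\<le>n. (\<forall>\<^sub>F y in F. B k x y) \<longrightarrow> (\<forall>y\<in>A'. B k x y)))"
  define D where "D = (\<lambda>x (n::nat). {y. \<forall>k\<le>n. (\<forall>\<^sub>F y in F. B k x y) \<longrightarrow> B k x y})"
  have Fbot: "F \<noteq> bot"
    unfolding F_def using net_filter_neq_bot[OF dir] by (simp add: filtermap_bot_iff)
  have FZ: "\<forall>\<^sub>F y in F. y \<in> Z"
    unfolding F_def eventually_filtermap eventually_net_filter[OF dir]
    using dir zZ unfolding directed_index_def by blast
  have FD: "\<forall>\<^sub>F y in F. y \<in> D x n" for x n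
  proof -
    have "\<forall>\<^sub>F y in F. \<forall>k\<in>{..n}. (\<forall>\<^sub>F y in F. B k x y) \<longrightarrow> B k x y"
      by (rule eventually_ball_finite) (auto simp: eventually_mono)
    then show ?thesis unfolding D_def by (simp add: atMost_def)
  qed
  have R_iff: "R (x, A, n) (x', A', n') \<longleftrightarrow> A' \<subseteq> A \<and> n \<le> n' \<and> A' \<subseteq> D x n" for x A n x' A' n'
    unfolding R_def D_def by auto
  have dirM: "directed_index M R"
    unfolding directed_index_def
  proof (intro conjI ballI)
    obtain x where "x \<in> Z" using eventually_happens'[OF Fbot FZ] by blast
    then have "(x, Z, 0) \<in> M" unfolding M_def using FZ by simp
    then show "M \<noteq> {}" by blast
    show "transp_on M R" unfolding transp_on_def by (clarsimp simp: R_iff) blast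
    fix a b assume ab: "a \<in> M" "b \<in> M"
    obtain x A n where a: "a = (x, A, n)" by (cases a)
    obtain x' A' n' where b: "b = (x', A', n')" by (cases b)
    let ?C = "A \<inter> A' \<inter> D x n \<inter> D x' n'"
    have ev: "\<forall>\<^sub>F y in F. y \<in> ?C"
      using ab FD[of x n] FD[of x' n'] unfolding a b M_def by (auto simp: eventually_conj_iff)
    obtain y where "y \<in> ?C" using eventually_happens'[OF Fbot ev] by blast
    then have "(y, ?C, max n n') \<in> M" unfolding M_def using ev ab a M_def by auto
    moreover have "R a (y, ?C, max n n')" "R b (y, ?C, max n n')" unfolding a b R_iff by auto
    ultimately show "\<exists>c\<in>M. R a c \<and> R b c" by blast
  qed
  have "fst \<in> M \<rightarrow> Z" unfolding M_def by auto
  have cauM: "cauchy_net e M R fst"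
    unfolding cauchy_net_iff[OF dirM]
  proof
    fix k :: nat
    let ?A = "{x\<in>Z. \<forall>\<^sub>F y in F. B k x y}"
    have "\<forall>\<^sub>F x in F. \<forall>\<^sub>F y in F. B k x y"
    proof -
      obtain \<gamma>\<^sub>0 where "\<gamma>\<^sub>0 \<in> \<Lambda>" "\<forall>\<gamma>\<in>\<Lambda>. prec \<gamma>\<^sub>0 \<gamma> \<longrightarrow> (\<forall>\<delta>\<in>\<Lambda>. prec \<gamma> \<delta> \<longrightarrow> B k (z \<gamma>) (z \<delta>))"
        using cau unfolding cauchy_net_iff[OF dir] B_def by blast
      then show ?thesis
        unfolding F_def eventually_filtermap eventually_net_filter[OF dir] by blast
    qed
    then have evA: "\<forall>\<^sub>F x in F. x \<in> ?A" using FZ by (auto simp: eventually_conj_iff)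
    obtain x\<^sub>0 where "x\<^sub>0 \<in> ?A" using eventually_happens'[OF Fbot evA] by blast
    then have M0: "(x\<^sub>0, ?A, k) \<in> M" unfolding M_def using evA by auto
    have "e (fst b) (fst c) \<le> ennreal (1 / Suc k)"
      if bc: "b \<in> M" "R (x\<^sub>0, ?A, k) b" "c \<in> M" "R b c" for b c
    proof -
      obtain x A n where b: "b = (x, A, n)" by (cases b)
      obtain y C m where c: "c = (y, C, m)" by (cases c)
      have "x \<in> A" "y \<in> C" using bc(1,3) unfolding b c M_def by auto
      moreover have "A \<subseteq> ?A" "k \<le> n" using bc(2) unfolding b R_iff by auto
      moreover have "C \<subseteq> D x n" using bc(4) unfolding b c R_iff by auto
      ultimately have "B k x y" unfolding D_def by blast
      then show ?thesis unfolding b c B_def by simp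
    qed
    with M0 show "\<exists>a\<in>M. \<forall>b\<in>M. R a b \<longrightarrow>
        (\<forall>c\<in>M. R b c \<longrightarrow> e (fst b) (fst c) \<le> ennreal (1 / Suc k))" by blast
  qed
  have "filtermap fst (net_filter M R) = F"
  proof (rule filter_eq_iff[THEN iffD2], rule allI)
    fix P
    show "eventually P (filtermap fst (net_filter M R)) \<longleftrightarrow> eventually P F"
    proof
      assume "eventually P (filtermap fst (net_filter M R))"
      then obtain a where a: "a \<in> M" "\<And>b. b \<in> M \<Longrightarrow> R a b \<Longrightarrow> P (fst b)"
        unfolding eventually_filtermap eventually_net_filter[OF dirM] by blast
      obtain x A n where a_eq: "a = (x, A, n)" by (cases a)
      let ?C = "A \<inter> D x n"
      have ev: "\<forall>\<^sub>F y in F. y \<in> ?C"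
        using a(1) FD[of x n] unfolding a_eq M_def by (auto simp: eventually_conj_iff)
      have "P y" if "y \<in> ?C" for y
      proof -
        have "(y, ?C, n) \<in> M" using that ev a(1) unfolding a_eq M_def by auto
        moreover have "R a (y, ?C, n)" unfolding a_eq R_iff by auto
        ultimately show ?thesis using a(2) by fastforce
      qed
      with ev show "eventually P F" by (rule eventually_mono)
    next
      assume "eventually P F"
      then have ev: "\<forall>\<^sub>F y in F. y \<in> {y\<in>Z. P y}" using FZ by (auto simp: eventually_conj_iff)
      obtain x where "x \<in> {y\<in>Z. P y}" using eventually_happens'[OF Fbot ev] by blast
      then have M0: "(x, {y\<in>Z. P y}, 0) \<in> M" unfolding M_def using ev by auto
      have "P (fst b)" if "b \<in> M" "R (x, {y\<in>Z. P y}, 0) b" for b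
      proof -
        obtain y C n where b: "b = (y, C, n)" by (cases b)
        show ?thesis using that unfolding b R_iff M_def by auto
      qed
      with M0 show "eventually P (filtermap fst (net_filter M R))"
        unfolding eventually_filtermap eventually_net_filter[OF dirM] by blast
    qed
  qed
  with dirM \<open>fst \<in> M \<rightarrow> Z\<close> cauM show thesis unfolding F_def by (rule that)
qed

lemma Liminf_filtermap_net:
  fixes r :: "'a \<Rightarrow> ennreal"
  shows "Liminf F (\<lambda>\<mu>. r (z \<mu>)) = Liminf (filtermap z F) r"
proof (rule antisym)
  show "Liminf F (\<lambda>\<mu>. r (z \<mu>)) \<le> Liminf (filtermap z F) r"
    unfolding Liminf_def[of F]
  proof (rule SUP_least)
    fix P assume "P \<in> {P. eventually P F}"
    then have P: "eventually P F" by simp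
    let ?m = "INF \<mu>\<in>Collect P. r (z \<mu>)"
    have "\<forall>\<^sub>F \<mu> in F. ?m \<le> r (z \<mu>)"
      using P by (rule eventually_mono) (rule INF_lower, simp)
    then have "\<forall>\<^sub>F x in filtermap z F. ?m \<le> r x" by (simp add: eventually_filtermap)
    then show "?m \<le> Liminf (filtermap z F) r" by (rule Liminf_bounded)
  qed
qed (rule Liminf_filtermap_le)

lemma net_limit_cong:
  assumes "filtermap w (net_filter M R) = filtermap z (net_filter \<Lambda> prec)"
  shows "net_limit Z e M R w l \<longleftrightarrow> net_limit Z e \<Lambda> prec z l"
  unfolding net_limit_def
    Liminf_filtermap_net[of _ "\<lambda>x. e x _" w] Liminf_filtermap_net[of _ "\<lambda>x. e x _" z]
    Liminf_filtermap_net[of _ "e _" w] Liminf_filtermap_net[of _ "e _" z] assms ..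

lemma net_completeD:
  fixes \<Lambda> :: "'i set"
  assumes "net_complete Z e" "directed_index \<Lambda> prec" "z \<in> \<Lambda> \<rightarrow> Z" "cauchy_net e \<Lambda> prec z"
  shows "\<exists>l. net_limit Z e \<Lambda> prec z l"
proof -
  obtain M :: "'a net_index set" and R w where
    M: "directed_index M R" "w \<in> M \<rightarrow> Z" "cauchy_net e M R w" and
    eq: "filtermap w (net_filter M R) = filtermap z (net_filter \<Lambda> prec)"
    by (rule cauchy_net_reindex[OF assms(2-4)])
  from assms(1) M have "\<exists>l. net_limit Z e M R w l" unfolding net_complete_def by blast
  then show ?thesis unfolding net_limit_cong[OF eq] .
qed

lemma finite_elementsD:
  fixes \<Lambda> :: "'i set"
  assumes "y \<in> finite_elements X d" "directed_index \<Lambda> prec" "x \<in> \<Lambda> \<rightarrow> X" "cauchy_net d \<Lambda> prec x"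
    "net_limit X d \<Lambda> prec x l"
  shows "((\<lambda>\<mu>. d y (x \<mu>)) \<longlongrightarrow> d y l) (net_filter \<Lambda> prec)"
proof -
  obtain M :: "'a net_index set" and R w where
    M: "directed_index M R" "w \<in> M \<rightarrow> X" "cauchy_net d M R w" and
    eq: "filtermap w (net_filter M R) = filtermap x (net_filter \<Lambda> prec)"
    by (rule cauchy_net_reindex[OF assms(2-4)])
  have lim: "net_limit X d M R w l" using assms(5) unfolding net_limit_cong[OF eq] .
  with assms(1) M lim have "((\<lambda>\<mu>. d y (w \<mu>)) \<longlongrightarrow> d y l) (net_filter M R)"
    unfolding finite_elements_def by blast
  then have "(d y \<longlongrightarrow> d y l) (filtermap w (net_filter M R))"
    by (simp add: filterlim_filtermap)
  then show ?thesis unfolding eq by (simp add: filterlim_filtermap)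
qed

end

theory Submission
  imports Defs
begin

text \<open>
  A net of functions that is Cauchy for the supremum distance is Cauchy at every point, so
  completeness of \<open>X\<close> provides a limit at each point. Any choice of these gives a limit function
  \<open>f\<close>. That \<open>f\<close> is a limit for the supremum distance is inherited from the points, because the
  supremum distance dominates every pointwise distance (\<open>net_limit_sup_dist\<close>).

  The substance is the continuity of \<open>f\<close>, which is the argument that a uniform limit of continuous
  functions is continuous, except that the distance has no symmetry to offer. By the triangle
  inequality
  \<open>d c (f q) \<le> d c (f\<^sub>\<mu> q) + d (f\<^sub>\<mu> q) (f q)\<close>, where the second summand is uniformly small in \<open>q\<close> by
  the Cauchy property (\<open>net_limit_dist_le\<close>); this uses only distances towards the limit. To carry
  the bound \<open>d c (f p) < \<epsilon>\<close> at a fixed \<open>p\<close> over to \<open>f\<^sub>\<mu>\<close>, the triangle inequality would need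
  \<open>d (f p) (f\<^sub>\<mu> p)\<close>, which may be large. Here finiteness of \<open>c\<close> steps in: it says precisely that
  \<open>d c (f\<^sub>\<mu> p)\<close> converges to \<open>d c (f p)\<close>.
\<close>

lemma continuous_map_finite_topology_iff:
  "continuous_map Q (finite_topology X d) f \<longleftrightarrow>
     f \<in> topspace Q \<rightarrow> X \<and>
     (\<forall>c\<in>finite_elements X d. \<forall>\<epsilon>>0. openin Q {p\<in>topspace Q. d c (f p) < ennreal \<epsilon>})"
proof (cases "f \<in> topspace Q \<rightarrow> X")
  case True
  then have "f -` X \<inter> topspace Q = topspace Q" by auto
  then have whole: "openin Q (f -` X \<inter> topspace Q)" by simp
  from True have ball:
    "f -` {x\<in>X. d c x < ennreal \<epsilon>} \<inter> topspace Q = {p\<in>topspace Q. d c (f p) < ennreal \<epsilon>}" for c \<epsilon>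
    by auto
  define \<B> where
    "\<B> = {{x\<in>X. d c x < ennreal \<epsilon>} | c \<epsilon>. c \<in> finite_elements X d \<and> \<epsilon> > 0}"
  from True have cover: "f ` topspace Q \<subseteq> \<Union>(insert X \<B>)" by auto
  have "continuous_map Q (finite_topology X d) f \<longleftrightarrow>
      (\<forall>U. U \<in> \<B> \<longrightarrow> openin Q (f -` U \<inter> topspace Q))"
    unfolding finite_topology_def \<B>_def[symmetric] continuous_on_generated_topo_iff
    using whole cover by (metis insert_iff)
  also have "\<dots> \<longleftrightarrow> (\<forall>c \<epsilon>. c \<in> finite_elements X d \<and> \<epsilon> > 0 \<longrightarrow>
      openin Q (f -` {x\<in>X. d c x < ennreal \<epsilon>} \<inter> topspace Q))"
    unfolding \<B>_def by blast
  finally show ?thesis using True unfolding ball by blast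
next
  case False
  then show ?thesis
    using continuous_map_image_subset_topspace[of Q "finite_topology X d" f]
    by (auto simp: topspace_finite_topology)
qed

lemma cauchy_net_eventually_le:
  assumes "directed_index \<Lambda> prec" "cauchy_net e \<Lambda> prec z" "0 < s"
  shows "\<forall>\<^sub>F \<gamma> in net_filter \<Lambda> prec. \<gamma> \<in> \<Lambda> \<and> (\<forall>\<delta>\<in>\<Lambda>. prec \<gamma> \<delta> \<longrightarrow> e (z \<gamma>) (z \<delta>) \<le> s)"
proof -
  have "\<forall>\<^sub>F \<gamma> in net_filter \<Lambda> prec. (SUP \<delta>\<in>{\<delta>\<in>\<Lambda>. prec \<gamma> \<delta>}. e (z \<gamma>) (z \<delta>)) < s"
    using assms(2,3) unfolding cauchy_net_def by (rule order_tendstoD)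
  moreover have "\<forall>\<^sub>F \<gamma> in net_filter \<Lambda> prec. \<gamma> \<in> \<Lambda>"
    using assms(1) unfolding eventually_net_filter[OF assms(1)] directed_index_def by blast
  ultimately show ?thesis
  proof eventually_elim
    case (elim \<gamma>)
    have "e (z \<gamma>) (z \<delta>) \<le> s" if "\<delta> \<in> \<Lambda>" "prec \<gamma> \<delta>" for \<delta>
    proof -
      have "e (z \<gamma>) (z \<delta>) \<le> (SUP \<delta>\<in>{\<delta>\<in>\<Lambda>. prec \<gamma> \<delta>}. e (z \<gamma>) (z \<delta>))"
        by (rule SUP_upper) (use that in auto)
      with elim(1) show ?thesis by simp
    qed
    with elim(2) show ?case by blast
  qed
qed

text \<open>
  A bound on the distances from a member of the net to the later ones survives in the limit,
  because distances towards a limit are bounded by the inferior limit of those towards the net,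
  with that member itself as test point.
\<close>

lemma net_limit_dist_le:
  assumes dir: "directed_index \<Lambda> prec" and lim: "net_limit X d \<Lambda> prec z l"
    and \<gamma>: "\<gamma> \<in> \<Lambda>" "z \<gamma> \<in> X" and le: "\<forall>\<delta>\<in>\<Lambda>. prec \<gamma> \<delta> \<longrightarrow> d (z \<gamma>) (z \<delta>) \<le> s"
  shows "d (z \<gamma>) l \<le> s"
proof -
  have "d (z \<gamma>) l \<le> Liminf (net_filter \<Lambda> prec) (\<lambda>\<mu>. d (z \<gamma>) (z \<mu>))"
    using lim \<gamma>(2) unfolding net_limit_def by blast
  also have "\<dots> \<le> Limsup (net_filter \<Lambda> prec) (\<lambda>\<mu>. d (z \<gamma>) (z \<mu>))"
    by (rule Liminf_le_Limsup[OF net_filter_neq_bot[OF dir]])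
  also have "\<dots> \<le> s"
    by (rule Limsup_bounded) (use \<gamma>(1) le in \<open>auto simp: eventually_net_filter[OF dir]\<close>)
  finally show ?thesis .
qed

lemma dist_le_sup_dist: "p \<in> Q \<Longrightarrow> d (f p) (g p) \<le> sup_dist Q d f g"
  unfolding sup_dist_def by (rule SUP_upper)

lemma cauchy_net_pointwise:
  assumes "directed_index \<Lambda> prec" "cauchy_net (sup_dist Q d) \<Lambda> prec z" "p \<in> Q"
  shows "cauchy_net d \<Lambda> prec (\<lambda>\<mu>. z \<mu> p)"
proof -
  have "d (z \<gamma> p) (z \<delta> p) \<le> r" if "sup_dist Q d (z \<gamma>) (z \<delta>) \<le> r" for \<gamma> \<delta> r
    using dist_le_sup_dist[OF assms(3)] that by (rule order_trans)
  with assms(2) show ?thesis unfolding cauchy_net_iff[OF assms(1)] by blast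
qed

text \<open>
  The defining inequalities of a limit are lower bounds on inferior limits, so they pass from
  the pointwise distances to their supremum.
\<close>

lemma net_limit_sup_dist:
  assumes "f \<in> C" and CX: "\<And>g p. g \<in> C \<Longrightarrow> p \<in> Q \<Longrightarrow> g p \<in> X"
    and lim: "\<And>p. p \<in> Q \<Longrightarrow> net_limit X d \<Lambda> prec (\<lambda>\<mu>. z \<mu> p) (f p)"
  shows "net_limit C (sup_dist Q d) \<Lambda> prec z f"
  unfolding net_limit_def
proof (intro conjI ballI)
  let ?F = "net_filter \<Lambda> prec"
  fix g assume g: "g \<in> C"
  show "sup_dist Q d f g \<le> Liminf ?F (\<lambda>\<mu>. sup_dist Q d (z \<mu>) g)"
    unfolding sup_dist_def[of Q d f]
  proof (rule SUP_least)
    fix p assume p: "p \<in> Q"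
    have "d (f p) (g p) \<le> Liminf ?F (\<lambda>\<mu>. d (z \<mu> p) (g p))"
      using lim[OF p] CX[OF g p] unfolding net_limit_def by blast
    also have "\<dots> \<le> Liminf ?F (\<lambda>\<mu>. sup_dist Q d (z \<mu>) g)"
      by (intro Liminf_mono always_eventually allI dist_le_sup_dist p)
    finally show "d (f p) (g p) \<le> Liminf ?F (\<lambda>\<mu>. sup_dist Q d (z \<mu>) g)" .
  qed
  show "sup_dist Q d g f \<le> Liminf ?F (\<lambda>\<mu>. sup_dist Q d g (z \<mu>))"
    unfolding sup_dist_def[of Q d g f]
  proof (rule SUP_least)
    fix p assume p: "p \<in> Q"
    have "d (g p) (f p) \<le> Liminf ?F (\<lambda>\<mu>. d (g p) (z \<mu> p))"
      using lim[OF p] CX[OF g p] unfolding net_limit_def by blast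
    also have "\<dots> \<le> Liminf ?F (\<lambda>\<mu>. sup_dist Q d g (z \<mu>))"
      by (intro Liminf_mono always_eventually allI dist_le_sup_dist p)
    finally show "d (g p) (f p) \<le> Liminf ?F (\<lambda>\<mu>. sup_dist Q d g (z \<mu>))" .
  qed
qed (fact \<open>f \<in> C\<close>)

text \<open>
  The uniform limit theorem for the finite topology. The only step that goes from the limit back
  to the net is at a single point, so pointwise convergence of \<open>d c\<close> along the net is enough
  there; the return to the limit is uniform because the supremum distance controls it.
\<close>

lemma continuous_map_sup_dist_limit:
  assumes dist: "distance_on X d"
    and dir: "directed_index \<Lambda> prec"
    and cont: "\<And>\<mu>. \<mu> \<in> \<Lambda> \<Longrightarrow> continuous_map Q (finite_topology X d) (z \<mu>)"
    and cau: "cauchy_net (sup_dist (topspace Q) d) \<Lambda> prec z"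
    and lim: "\<And>p. p \<in> topspace Q \<Longrightarrow> net_limit X d \<Lambda> prec (\<lambda>\<mu>. z \<mu> p) (f p)"
  shows "continuous_map Q (finite_topology X d) f"
  unfolding continuous_map_finite_topology_iff
proof (intro conjI ballI allI impI)
  show fX: "f \<in> topspace Q \<rightarrow> X"
    using lim unfolding net_limit_def by blast
  have zX: "z \<mu> p \<in> X" if "\<mu> \<in> \<Lambda>" "p \<in> topspace Q" for \<mu> p
    using cont[OF that(1)] that(2) unfolding continuous_map_finite_topology_iff by blast
  fix c and \<epsilon> :: real assume c: "c \<in> finite_elements X d" and "0 < \<epsilon>"
  have cX: "c \<in> X" using c unfolding finite_elements_def by blast
  show "openin Q {p\<in>topspace Q. d c (f p) < ennreal \<epsilon>}"
  proof (subst openin_subopen, rule ballI)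
    fix p assume "p \<in> {p\<in>topspace Q. d c (f p) < ennreal \<epsilon>}"
    then have p: "p \<in> topspace Q" and fp: "d c (f p) < ennreal \<epsilon>" by auto
    obtain r where r: "d c (f p) < r" "r < ennreal \<epsilon>" using dense[OF fp] by blast
    from r(1) have "0 < r" by (rule le_less_trans[OF zero_le])
    with r(2) obtain t where t: "r = ennreal t" "0 < t" "t < \<epsilon>"
      by (cases r) (auto simp: ennreal_less_iff)
    have "cauchy_net d \<Lambda> prec (\<lambda>\<mu>. z \<mu> p)"
      by (rule cauchy_net_pointwise[OF dir cau p])
    then have "((\<lambda>\<mu>. d c (z \<mu> p)) \<longlongrightarrow> d c (f p)) (net_filter \<Lambda> prec)"
      using zX p lim[OF p] by (intro finite_elementsD[OF c dir]) auto
    then have "\<forall>\<^sub>F \<mu> in net_filter \<Lambda> prec. d c (z \<mu> p) < ennreal t"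
      using r(1) unfolding t(1) by (rule order_tendstoD)
    moreover have "\<forall>\<^sub>F \<mu> in net_filter \<Lambda> prec. \<mu> \<in> \<Lambda> \<and>
        (\<forall>\<delta>\<in>\<Lambda>. prec \<mu> \<delta> \<longrightarrow> sup_dist (topspace Q) d (z \<mu>) (z \<delta>) \<le> ennreal (\<epsilon> - t))"
      using t(3) by (intro cauchy_net_eventually_le[OF dir cau]) simp
    ultimately have "\<forall>\<^sub>F \<mu> in net_filter \<Lambda> prec. d c (z \<mu> p) < ennreal t \<and> \<mu> \<in> \<Lambda> \<and>
        (\<forall>\<delta>\<in>\<Lambda>. prec \<mu> \<delta> \<longrightarrow> sup_dist (topspace Q) d (z \<mu>) (z \<delta>) \<le> ennreal (\<epsilon> - t))"
      by (rule eventually_conj)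
    then obtain \<mu> where \<mu>: "\<mu> \<in> \<Lambda>" "d c (z \<mu> p) < ennreal t" and
      tail: "\<And>\<delta>. \<delta> \<in> \<Lambda> \<Longrightarrow> prec \<mu> \<delta> \<Longrightarrow> sup_dist (topspace Q) d (z \<mu>) (z \<delta>) \<le> ennreal (\<epsilon> - t)"
      using eventually_happens'[OF net_filter_neq_bot[OF dir]] by blast
    have close: "d (z \<mu> q) (f q) \<le> ennreal (\<epsilon> - t)" if q: "q \<in> topspace Q" for q
    proof (rule net_limit_dist_le[OF dir lim[OF q] \<mu>(1) zX[OF \<mu>(1) q]], intro ballI impI)
      fix \<delta> assume "\<delta> \<in> \<Lambda>" "prec \<mu> \<delta>"
      then have "sup_dist (topspace Q) d (z \<mu>) (z \<delta>) \<le> ennreal (\<epsilon> - t)" by (rule tail)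
      with dist_le_sup_dist[OF q]
      show "d (z \<mu> q) (z \<delta> q) \<le> ennreal (\<epsilon> - t)" by (rule order_trans)
    qed
    let ?U = "{q\<in>topspace Q. d c (z \<mu> q) < ennreal t}"
    have "d c (f q) < ennreal \<epsilon>" if q: "q \<in> ?U" for q
    proof -
      from q have "d c (f q) \<le> d c (z \<mu> q) + d (z \<mu> q) (f q)"
        using dist cX zX[OF \<mu>(1)] fX unfolding distance_on_def by blast
      also have "\<dots> \<le> d c (z \<mu> q) + ennreal (\<epsilon> - t)"
        using q by (intro add_left_mono close) simp
      also have "\<dots> < ennreal t + ennreal (\<epsilon> - t)"
        using q unfolding add.commute[of _ "ennreal (\<epsilon> - t)"] ennreal_add_left_cancel_less by simp
      also have "\<dots> = ennreal \<epsilon>"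
        using t(2,3) by (simp flip: ennreal_plus)
      finally show ?thesis .
    qed
    moreover have "openin Q ?U"
      using cont[OF \<mu>(1)] c t(2) unfolding continuous_map_finite_topology_iff by blast
    ultimately show "\<exists>T. openin Q T \<and> p \<in> T \<and> T \<subseteq> {p\<in>topspace Q. d c (f p) < ennreal \<epsilon>}"
      using p \<mu>(2) by (intro exI[of _ ?U]) auto
  qed
qed

theorem theorem2:
  fixes X :: "'a set" and d :: "'a \<Rightarrow> 'a \<Rightarrow> ennreal" and Q :: "'q topology"
  assumes "distance_on X d" and "net_complete X d"
  shows "net_complete (cont_funs Q (finite_topology X d)) (sup_dist (topspace Q) d)"
  unfolding net_complete_def
proof (intro allI impI, elim conjE)
  let ?C = "cont_funs Q (finite_topology X d)"
  fix \<Lambda> :: "('q \<Rightarrow> 'a) net_index set" and prec z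
  assume dir: "directed_index \<Lambda> prec" and zC: "z \<in> \<Lambda> \<rightarrow> ?C"
    and cau: "cauchy_net (sup_dist (topspace Q) d) \<Lambda> prec z"
  have CX: "g p \<in> X" if "g \<in> ?C" "p \<in> topspace Q" for g p
    using that unfolding cont_funs_def continuous_map_finite_topology_iff by blast
  have "\<exists>l. net_limit X d \<Lambda> prec (\<lambda>\<mu>. z \<mu> p) l" if p: "p \<in> topspace Q" for p
    using cauchy_net_pointwise[OF dir cau p] zC CX p
    by (intro net_completeD[OF assms(2) dir]) auto
  then obtain f\<^sub>0 where
    f\<^sub>0: "\<And>p. p \<in> topspace Q \<Longrightarrow> net_limit X d \<Lambda> prec (\<lambda>\<mu>. z \<mu> p) (f\<^sub>0 p)"
    by metis
  define f where "f = restrict f\<^sub>0 (topspace Q)"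
  have lim: "net_limit X d \<Lambda> prec (\<lambda>\<mu>. z \<mu> p) (f p)" if "p \<in> topspace Q" for p
    using f\<^sub>0[OF that] that unfolding f_def by simp
  have "continuous_map Q (finite_topology X d) f"
    by (rule continuous_map_sup_dist_limit[OF assms(1) dir _ cau lim])
      (use zC in \<open>auto simp: cont_funs_def\<close>)
  then have "f \<in> ?C" unfolding cont_funs_def f_def by simp
  then have "net_limit ?C (sup_dist (topspace Q) d) \<Lambda> prec z f"
    using CX lim by (rule net_limit_sup_dist)
  then show "\<exists>l. net_limit ?C (sup_dist (topspace Q) d) \<Lambda> prec z l" by blast
qed

end
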